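(* Let $G$ be a topological group and let $X$ be a distributive binary $G$-space. Then, for arbitrary $x,y,z\in X$ and $g\in G$, the following equalities hold: \[ G_{(g(x,y),g(x,z))}=G_{(y,z)}, \] \[ G_{(x,g(x,x))}=G_{(x,x)}, \] \[ G_{(g(x,x),x)}=G_{(x,x)}. \]
   Context: Let $G$ be a topological group with identity $e$ and $X$ a topological space. A binary action of $G$ on $X$ is a continuous map $\alpha:G\times X^2\to X$, written $g(x,y)=\alpha(g,x,y)$, such that $gh(x,y)=g(x,h(x,y))$ and $e(x,y)=y$ for all $g,h\in G$ and $x,y\in X$ (here $gh(x,y)$ means $(gh)(x,y)$). A space $X$ with a fixed binary action of $G$ is called a binary $G$-space. It is called distributive if $g(x,h(y,z))=h(g(x,y),g(x,z))$ for all $x,y,z\in X$ and $g,h\in G$. For points $x,y$ of a binary $G$-space, the stationary subgroup of the pair $(x,y)$ is $G_{(x,y)}=\{g\in G : g(x,y)=y\}$. *)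

theory Defs
  imports "HOL-Analysis.Product_Topology" "HOL-Algebra.Group"
begin

locale topological_group = group G
  for G :: "('g, 'm) monoid_scheme" (structure) and T :: "'g topology" +
  assumes topspace_eq_carrier: "topspace T = carrier G"
    and continuous_mult: "continuous_map (prod_topology T T) T (\<lambda>(g, h). g \<otimes> h)"
    and continuous_inv: "continuous_map T T (\<lambda>g. inv g)"

text \<open>
  The underlying set of the space \<open>X\<close> is \<open>topspace X\<close>; the value \<open>g(x,y)\<close> of the action is
  written \<open>act g x y\<close>. That \<open>act\<close> maps into \<open>topspace X\<close> is part of \<open>continuous_map\<close>.
\<close>
locale binary_G_space = topological_group G T
  for G :: "('g, 'm) monoid_scheme" (structure) and T :: "'g topology" +
  fixes X :: "'x topology" and act :: "'g \<Rightarrow> 'x \<Rightarrow> 'x \<Rightarrow> 'x"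
  assumes continuous_act:
      "continuous_map (prod_topology T (prod_topology X X)) X (\<lambda>(g, x, y). act g x y)"
    and act_mult:
      "\<lbrakk>g \<in> carrier G; h \<in> carrier G; x \<in> topspace X; y \<in> topspace X\<rbrakk>
        \<Longrightarrow> act (g \<otimes> h) x y = act g x (act h x y)"
    and act_one: "\<lbrakk>x \<in> topspace X; y \<in> topspace X\<rbrakk> \<Longrightarrow> act \<one> x y = y"

locale distributive_binary_G_space = binary_G_space G T X act
  for G :: "('g, 'm) monoid_scheme" (structure) and T :: "'g topology"
    and X :: "'x topology" and act :: "'g \<Rightarrow> 'x \<Rightarrow> 'x \<Rightarrow> 'x" +
  assumes distributive:
    "\<lbrakk>g \<in> carrier G; h \<in> carrier G; x \<in> topspace X; y \<in> topspace X; z \<in> topspace X\<rbrakk>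
      \<Longrightarrow> act g x (act h y z) = act h (act g x y) (act g x z)"

definition stationary_subgroup ::
    "('g, 'm) monoid_scheme \<Rightarrow> ('g \<Rightarrow> 'x \<Rightarrow> 'x \<Rightarrow> 'x) \<Rightarrow> 'x \<Rightarrow> 'x \<Rightarrow> 'g set"
  where "stationary_subgroup G act x y = {g \<in> carrier G. act g x y = y}"

end

theory Submission
  imports Defs
begin

text \<open>
  Write \<open>K\<close> for the stationary subgroup of \<open>(x, x)\<close>. For fixed \<open>x\<close> the map \<open>y \<mapsto> g(x,y)\<close> is
  a bijection with inverse \<open>y \<mapsto> g\<inverse>(x,y)\<close>, and distributivity says that it is an automorphism of the
  whole structure: it carries \<open>h(y,z)\<close> to \<open>h(g(x,y),g(x,z))\<close>. Automorphisms preserve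
  stationary subgroups, which is the first equality.

  For fixed \<open>x\<close> the maps \<open>y \<mapsto> g(x,y)\<close> form an ordinary action of \<open>G\<close>, in which
  \<open>K\<close> is the stabilizer of the point \<open>x\<close> and the stabilizer of \<open>g(x,x)\<close> is \<open>g K g\<inverse>\<close>. So the second
  equality states that \<open>K\<close> is normal. If \<open>h\<close> lies in \<open>K\<close>, distributivity with the two group elements
  exchanged gives \<open>h(x,g(x,x)) = g(h(x,x),h(x,x)) = g(x,x)\<close>, that is,
  \<open>K \<subseteq> g K g\<inverse>\<close>. This holds for all \<open>g\<close>, so using it for \<open>g\<inverse>\<close> gives the reverse inclusion.

  For the third equality, write \<open>x = g(x,g\<inverse>(x,x))\<close>. The first equality turns the stationary subgroup
  of \<open>(g(x,x),x)\<close> into that of \<open>(x,g\<inverse>(x,x))\<close>, and the second turns this into \<open>K\<close>.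
\<close>

context binary_G_space
begin

lemma act_closed:
  assumes "g \<in> carrier G" "x \<in> topspace X" "y \<in> topspace X"
  shows "act g x y \<in> topspace X"
  using continuous_map_image_subset_topspace[OF continuous_act] assms topspace_eq_carrier
  by (auto simp: image_subset_iff)

lemma act_inv_act:
  assumes "g \<in> carrier G" "x \<in> topspace X" "y \<in> topspace X"
  shows "act (inv g) x (act g x y) = y"
  using assms act_mult[of "inv g" g x y] by (simp add: act_one)

lemma act_act_inv:
  assumes "g \<in> carrier G" "x \<in> topspace X" "y \<in> topspace X"
  shows "act g x (act (inv g) x y) = y"
  using assms act_mult[of g "inv g" x y] by (simp add: act_one)

lemma act_eq_iff:
  assumes "g \<in> carrier G" "x \<in> topspace X" "y \<in> topspace X" "z \<in> topspace X"
  shows "act g x y = act g x z \<longleftrightarrow> y = z"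
  using assms by (metis act_inv_act)

end

context distributive_binary_G_space
begin

lemma stationary_subgroup_translate:
  assumes "g \<in> carrier G" "x \<in> topspace X" "y \<in> topspace X" "z \<in> topspace X"
  shows "stationary_subgroup G act (act g x y) (act g x z) = stationary_subgroup G act y z"
proof -
  have "act h (act g x y) (act g x z) = act g x z \<longleftrightarrow> act h y z = z" if h: "h \<in> carrier G" for h
    using assms h by (simp add: act_eq_iff act_closed flip: distributive)
  then show ?thesis
    by (auto simp: stationary_subgroup_def)
qed

text \<open>
  Exchanging \<open>g\<close> and \<open>h\<close> in the distributive law makes \<open>h\<close> act on both copies of \<open>x\<close>
  inside \<open>g(x,x)\<close>, and these are fixed by \<open>h\<close>.
\<close>

lemma act_diagonal_orbit_fixed:
  assumes "g \<in> carrier G" "h \<in> carrier G" "x \<in> topspace X" "act h x x = x"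
  shows "act h x (act g x x) = act g x x"
  using assms distributive[of h g x x x] by simp

text \<open>
  Stabilizers of points in the orbit of \<open>x\<close> are conjugate to that of \<open>x\<close>, so this is the normality of
  the stationary subgroup of \<open>(x, x)\<close>.
\<close>

lemma stationary_subgroup_diagonal_orbit:
  assumes g: "g \<in> carrier G" and x: "x \<in> topspace X"
  shows "stationary_subgroup G act x (act g x x) = stationary_subgroup G act x x"
proof -
  have "act h x x = x" if h: "h \<in> carrier G" and fixed: "act h x (act g x x) = act g x x" for h
  proof -
    let ?k = "inv g \<otimes> h \<otimes> g"
    have "act ?k x x = x"
      using g h x fixed by (simp add: act_mult act_closed act_inv_act)
    then have "act ?k x (act (inv g) x x) = act (inv g) x x"
      using g h x by (intro act_diagonal_orbit_fixed) auto
    then have "act (inv g) x (act h x x) = act (inv g) x x"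
      using g h x by (simp add: act_mult act_closed act_act_inv)
    then show ?thesis
      using g h x by (simp add: act_eq_iff act_closed)
  qed
  then show ?thesis
    unfolding stationary_subgroup_def using act_diagonal_orbit_fixed[OF g _ x] by blast
qed

lemma stationary_subgroup_orbit_diagonal:
  assumes g: "g \<in> carrier G" and x: "x \<in> topspace X"
  shows "stationary_subgroup G act (act g x x) x = stationary_subgroup G act x x"
proof -
  have "stationary_subgroup G act (act g x x) x
      = stationary_subgroup G act (act g x x) (act g x (act (inv g) x x))"
    using g x by (simp add: act_act_inv)
  also have "\<dots> = stationary_subgroup G act x (act (inv g) x x)"
    using g x by (intro stationary_subgroup_translate act_closed) auto
  also have "\<dots> = stationary_subgroup G act x x"
    using g x by (intro stationary_subgroup_diagonal_orbit) auto
  finally show ?thesis .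
qed

end

theorem proposition4p4:
  fixes G :: "('g, 'm) monoid_scheme" and T :: "'g topology"
    and X :: "'x topology" and act :: "'g \<Rightarrow> 'x \<Rightarrow> 'x \<Rightarrow> 'x"
    and x y z :: 'x and g :: 'g
  assumes "distributive_binary_G_space G T X act"
    and "x \<in> topspace X" and "y \<in> topspace X" and "z \<in> topspace X"
    and "g \<in> carrier G"
  shows "stationary_subgroup G act (act g x y) (act g x z) = stationary_subgroup G act y z
    \<and> stationary_subgroup G act x (act g x x) = stationary_subgroup G act x x
    \<and> stationary_subgroup G act (act g x x) x = stationary_subgroup G act x x"
proof -
  interpret distributive_binary_G_space G T X act
    by (rule assms(1))
  show ?thesis
    using assms(2-5)
    by (intro conjI stationary_subgroup_translate stationary_subgroup_diagonal_orbit
        stationary_subgroup_orbit_diagonal)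
qed

end
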